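(* Let $K$ be a compact convex set in $\mathbb{R}^n$ with nonempty interior and $\alpha$ a sequence of unit vectors. Suppose that for every subsequential limit $L$ of $\mathrm{s}_\alpha K$, the limit $\mathrm{s}_\alpha L$ exists and $\mathrm{s}_\alpha L=L$. Then $\mathrm{s}_\alpha K$ exists (i.e. the Steiner process converges).
   Context: For a nonempty compact convex $K\subseteq\mathbb{R}^n$ and a unit vector $u$, the Steiner symmetrization $\mathrm{s}_uK$ is defined as follows: for each point $x$ of the orthogonal projection $\pi_uK$ of $K$ onto $u^\perp$, let $\ell_x(K)$ be the length of the segment $K\cap(x+\mathbb{R}u)$; then $\mathrm{s}_uK=\{x+tu:\ x\in\pi_uK,\ |t|\le \tfrac12\ell_x(K)\}$. Given a sequence $\alpha=(u_1,u_2,\dots)$ of unit vectors and $K$, the Steiner process is the sequence $K_i=\mathrm{s}_{u_i}\cdots\mathrm{s}_{u_1}K$; if $\lim_iK_i$ exists in the Hausdorff metric it is denoted $\mathrm{s}_\alpha K$, and a limit of a convergent subsequence of $(K_i)$ is called a subsequential limit of $\mathrm{s}_\alpha K$. *)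

theory Defs
  imports "HOL-Analysis.Analysis"
begin

text \<open>Hausdorff distance between nonempty compact sets (used only for such sets).\<close>
definition hausdist :: "'a::metric_space set \<Rightarrow> 'a set \<Rightarrow> real" where
  "hausdist S T = max (SUP x\<in>S. infdist x T) (SUP y\<in>T. infdist y S)"

definition proj_perp :: "'a::euclidean_space \<Rightarrow> 'a \<Rightarrow> 'a" where
  "proj_perp u x = x - (x \<bullet> u) *\<^sub>R u"

text \<open>Length of the chord K \<inter> (x + \<real>u) (u a unit vector, K compact convex):
  the line section is the segment {x + t u | t \<in> [a,b]}, of length b - a.\<close>
definition chord_length :: "'a::euclidean_space set \<Rightarrow> 'a \<Rightarrow> 'a \<Rightarrow> real" where
  "chord_length K u x = Sup {t. x + t *\<^sub>R u \<in> K} - Inf {t. x + t *\<^sub>R u \<in> K}"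

definition steiner :: "'a::euclidean_space \<Rightarrow> 'a set \<Rightarrow> 'a set" where
  "steiner u K = {x + t *\<^sub>R u | x t. x \<in> proj_perp u ` K \<and> \<bar>t\<bar> \<le> chord_length K u x / 2}"

text \<open>Steiner process: K_0 = K, K_(i+1) = s_(u_(i+1)) K_i; the direction sequence
  \<alpha> is indexed from 0, so \<alpha> i is the (i+1)-st direction.\<close>
primrec steiner_seq :: "(nat \<Rightarrow> 'a::euclidean_space) \<Rightarrow> 'a set \<Rightarrow> nat \<Rightarrow> 'a set" where
  "steiner_seq \<alpha> K 0 = K"
| "steiner_seq \<alpha> K (Suc i) = steiner (\<alpha> i) (steiner_seq \<alpha> K i)"

definition steiner_limit :: "(nat \<Rightarrow> 'a::euclidean_space) \<Rightarrow> 'a set \<Rightarrow> 'a set \<Rightarrow> bool" where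
  "steiner_limit \<alpha> K L \<longleftrightarrow> compact L \<and> L \<noteq> {} \<and>
     (\<lambda>i. hausdist (steiner_seq \<alpha> K i) L) \<longlonglongrightarrow> 0"

definition steiner_subseq_limit :: "(nat \<Rightarrow> 'a::euclidean_space) \<Rightarrow> 'a set \<Rightarrow> 'a set \<Rightarrow> bool" where
  "steiner_subseq_limit \<alpha> K L \<longleftrightarrow> compact L \<and> L \<noteq> {} \<and>
     (\<exists>r. strict_mono r \<and> (\<lambda>i. hausdist (steiner_seq \<alpha> K (r i)) L) \<longlonglongrightarrow> 0)"

end

theory Submission
  imports Defs "HOL-Complex_Analysis.Great_Picard"
begin

text \<open>
  Steiner symmetrization is monotone for inclusion and commutes with dilations about a point \<open>x\<close>, up to
  projecting \<open>x\<close>; it also maps a ball centred at \<open>x\<close> to the ball centred at the projection. Hence a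
  ball of radius \<open>r\<close> in \<open>K\<close> persists in all \<open>K\<^sub>i\<close>, with centres \<open>x\<^sub>i\<close>. If \<open>L\<close> is a subsequential limit,
  with Steiner process \<open>L\<^sub>i\<close> converging to \<open>L\<close>, then \<open>L\<^sub>i\<close> lies in an arbitrarily small neighbourhood of
  \<open>K\<^sub>i\<close> for some \<open>i\<close>, and the ball turns this into an inclusion of \<open>L\<^sub>i\<close> in a dilate of \<open>K\<^sub>i\<close> about \<open>x\<^sub>i\<close>
  with ratio close to 1. This inclusion is inherited by all later indices, so \<open>L\<close> is contained in
  every subsequential limit. By symmetry all subsequential limits coincide, and Blaschke selection
  yields convergence.
\<close>

section \<open>The Hausdorff distance and Blaschke selection\<close>

text \<open>A real \<open>SUP\<close> is informative only for a family bounded above. Boundedness of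
  \<open>S\<close> supplies this, since the distance to a fixed set is 1-Lipschitz.\<close>

lemma infdist_le_hausdist:
  fixes S T :: "'a::metric_space set"
  assumes "bounded S" "x \<in> S"
  shows "infdist x T \<le> hausdist S T"
proof -
  obtain B where B: "\<And>y. y \<in> S \<Longrightarrow> dist x y \<le> B"
    using assms(1) bounded_any_center[of S x] by auto
  have "bdd_above ((\<lambda>x. infdist x T) ` S)"
  proof (rule bdd_aboveI2)
    fix y assume "y \<in> S"
    then have "dist y x \<le> B" using B dist_commute by metis
    then show "infdist y T \<le> infdist x T + B"
      using infdist_triangle[of y T x] by linarith
  qed
  then have "infdist x T \<le> (SUP x\<in>S. infdist x T)"
    using assms(2) by (intro cSUP_upper)
  then show ?thesis
    unfolding hausdist_def by linarith
qed

lemma hausdist_commute: "hausdist S T = hausdist T S"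
  unfolding hausdist_def by (simp add: max.commute)

lemma hausdist_le:
  assumes "S \<noteq> {}" "T \<noteq> {}"
    and "\<And>x. x \<in> S \<Longrightarrow> infdist x T \<le> e" "\<And>y. y \<in> T \<Longrightarrow> infdist y S \<le> e"
  shows "hausdist S T \<le> e"
  unfolding hausdist_def using assms by (auto intro!: cSUP_least)

lemma hausdist_nonneg:
  assumes "bounded S" "S \<noteq> {}"
  shows "0 \<le> hausdist S T"
  using assms infdist_le_hausdist infdist_nonneg order_trans by (metis ex_in_conv)

lemma infdist_less_imp_dist_less:
  assumes "infdist x S < e" "S \<noteq> {}"
  obtains y where "y \<in> S" "dist x y < e"
proof -
  have "\<exists>y\<in>S. dist x y < e"
  proof (rule ccontr)
    assume "\<not> ?thesis"
    then have "e \<le> infdist x S"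
      using assms(2) by (auto simp: infdist_notempty intro!: cINF_greatest)
    then show False using assms(1) by simp
  qed
  then show ?thesis using that by blast
qed

text \<open>The functions \<^term>\<open>\<lambda>x. infdist x (S i)\<close> are equi-Lipschitz; the limit set is the zero set
  of a uniform limit supplied by Arzela--Ascoli.\<close>
theorem Blaschke_selection:
  fixes S :: "nat \<Rightarrow> 'a::euclidean_space set"
  assumes ne: "\<And>i. S i \<noteq> {}" and sub: "\<And>i. S i \<subseteq> cball 0 R"
  obtains L r where "compact L" "L \<noteq> {}" "strict_mono r" "(\<lambda>i. hausdist (S (r i)) L) \<longlonglongrightarrow> 0"
proof -
  define F where "F = (\<lambda>i x. infdist x (S i))"
  have bound: "norm (F i x) \<le> 2 * R" if x: "x \<in> cball 0 R" for i x
  proof -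
    obtain y where y: "y \<in> S i" using ne by blast
    have "norm y \<le> R" using sub y by force
    moreover have "norm x \<le> R" using x by simp
    ultimately have "dist x y \<le> 2 * R"
      by (metis dist_norm mult_2 norm_triangle_le_diff add_mono)
    then show ?thesis
      unfolding F_def using infdist_le2[OF y] infdist_nonneg[of x "S i"] by simp
  qed
  have lip: "norm (F i x - F i y) \<le> dist x y" for i x y
    unfolding F_def real_norm_def using infdist_triangle_abs by blast
  obtain g and r :: "nat \<Rightarrow> nat" where g: "continuous_on (cball 0 R) g" and r: "strict_mono r"
    and unif: "\<And>e. 0 < e \<Longrightarrow> \<exists>N. \<forall>n x. n \<ge> N \<and> x \<in> cball 0 R \<longrightarrow> norm (F (r n) x - g x) < e"
  proof (rule Arzela_Ascoli[of "cball 0 R" F "2 * R"])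
    fix x :: 'a and e :: real assume "x \<in> cball 0 R" "0 < e"
    then show "\<exists>d>0. \<forall>n y. y \<in> cball 0 R \<and> norm (x - y) < d \<longrightarrow> norm (F n x - F n y) < e"
      using lip by (metis dist_norm le_less_trans)
  qed (use bound compact_cball in blast)+
  define L where "L = {x \<in> cball 0 R. g x = 0}"
  have "closed L"
    unfolding L_def using continuous_closed_preimage_constant[OF g closed_cball] by simp
  then have L: "compact L"
    by (metis (no_types, lifting) L_def bounded_cball bounded_subset compact_eq_bounded_closed mem_Collect_eq subsetI)
  \<comment> \<open>The point of \<open>L\<close> is found by compactness: far along the sequence,
    \<open>S (r n)\<close> has points within \<open>e\<close> of \<open>x\<close>, and these
    accumulate at a zero of \<open>g\<close>.\<close>
  have near: "\<exists>y\<in>L. dist x y \<le> e" if x: "x \<in> cball 0 R" "g x < e" for x e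
  proof -
    obtain N where N: "\<And>n. n \<ge> N \<Longrightarrow> norm (F (r n) x - g x) < e - g x"
      using unif[of "e - g x"] x by auto
    have "\<exists>y. y \<in> S (r (n + N)) \<and> dist x y < e" for n
    proof -
      have "infdist x (S (r (n + N))) < e"
        using N[of "n + N"] unfolding F_def by simp
      then show ?thesis
        using infdist_less_imp_dist_less ne by metis
    qed
    then obtain y where y: "\<And>n. y n \<in> S (r (n + N))" "\<And>n. dist x (y n) < e"
      by metis
    have yR: "y n \<in> cball 0 R" for n using y sub by blast
    obtain l s where l: "l \<in> cball 0 R" "strict_mono s" "(y \<circ> s) \<longlonglongrightarrow> l"
      using compact_cball yR unfolding compact_def by metis
    \<comment> \<open>\<open>F (r (n + N))\<close> vanishes at \<open>y n\<close>, because
      \<open>y n\<close> lies in the corresponding set, and it is uniformly close to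
      \<open>g\<close>.\<close>
    have "(\<lambda>n. g (y n)) \<longlonglongrightarrow> 0"
    proof (rule LIMSEQ_I)
      fix d :: real assume "0 < d"
      then obtain M where M: "\<And>n x. n \<ge> M \<Longrightarrow> x \<in> cball 0 R \<Longrightarrow> norm (F (r n) x - g x) < d"
        using unif by blast
      have "norm (g (y n) - 0) < d" if "n \<ge> M" for n
        using M[of "n + N" "y n"] that yR[of n] y(1)[of n] unfolding F_def by simp
      then show "\<exists>M. \<forall>n\<ge>M. norm (g (y n) - 0) < d" by blast
    qed
    then have "(\<lambda>n. g ((y \<circ> s) n)) \<longlonglongrightarrow> 0"
      using LIMSEQ_subseq_LIMSEQ[OF _ l(2), of "\<lambda>n. g (y n)"] by (simp add: o_def)
    moreover have "(\<lambda>n. g ((y \<circ> s) n)) \<longlonglongrightarrow> g l"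
      using continuous_on_tendsto_compose[OF g l(3,1)] yR by simp
    ultimately have "g l = 0" using LIMSEQ_unique by blast
    moreover have "dist x l \<le> e"
    proof (rule LIMSEQ_le_const2)
      show "(\<lambda>n. dist x ((y \<circ> s) n)) \<longlonglongrightarrow> dist x l"
        using l(3) by (intro tendsto_intros)
      show "\<exists>N. \<forall>n\<ge>N. dist x ((y \<circ> s) n) \<le> e"
        using y(2) by (auto intro: less_imp_le)
    qed
    ultimately show ?thesis using l unfolding L_def by blast
  qed
  have "L \<noteq> {}"
  proof -
    obtain x where "x \<in> S 0" using ne by blast
    then have "x \<in> cball 0 R" using sub by blast
    then show ?thesis using near[of x "g x + 1"] by auto
  qed
  moreover have "(\<lambda>i. hausdist (S (r i)) L) \<longlonglongrightarrow> 0"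
  proof (rule LIMSEQ_I)
    fix e :: real assume "0 < e"
    then obtain N where N: "\<And>n x. n \<ge> N \<Longrightarrow> x \<in> cball 0 R \<Longrightarrow> norm (F (r n) x - g x) < e / 2"
      using unif[of "e / 2"] by auto
    have "norm (hausdist (S (r n)) L - 0) < e" if n: "n \<ge> N" for n
    proof -
      \<comment> \<open>\<open>F (r n)\<close> is zero on \<open>S (r n)\<close> and
        \<open>g\<close> is zero on \<open>L\<close>, so their uniform closeness controls both
        one-sided distances.\<close>
      have "hausdist (S (r n)) L \<le> e / 2"
      proof (rule hausdist_le)
        fix x assume x: "x \<in> S (r n)"
        then have xR: "x \<in> cball 0 R" using sub by blast
        then have "g x < e / 2" using N[OF n xR] x unfolding F_def by auto
        then show "infdist x L \<le> e / 2"
          using near[OF xR] infdist_le2 by metis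
      next
        fix y assume y: "y \<in> L"
        then have "norm (F (r n) y - g y) < e / 2" using N[OF n] unfolding L_def by blast
        then show "infdist y (S (r n)) \<le> e / 2" using y unfolding F_def L_def by auto
      qed (use ne \<open>L \<noteq> {}\<close> in auto)
      moreover have "0 \<le> hausdist (S (r n)) L"
        using hausdist_nonneg ne sub bounded_subset[OF bounded_cball] by metis
      ultimately show ?thesis using \<open>0 < e\<close> by simp
    qed
    then show "\<exists>N. \<forall>n\<ge>N. norm (hausdist (S (r n)) L - 0) < e" by blast
  qed
  ultimately show ?thesis using that L r by blast
qed

section \<open>Steiner symmetrization\<close>

lemma proj_perp_orthogonal: "norm u = 1 \<Longrightarrow> proj_perp u x \<bullet> u = 0"
  by (simp add: proj_perp_def inner_diff_left flip: norm_eq_1)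

lemma proj_perp_plus: "norm u = 1 \<Longrightarrow> p \<bullet> u = 0 \<Longrightarrow> proj_perp u (p + t *\<^sub>R u) = p"
  by (simp add: proj_perp_def inner_add_left norm_eq_1)

lemma linear_proj_perp: "linear (proj_perp u)"
  by (rule linearI) (simp_all add: proj_perp_def algebra_simps)

lemma proj_perp_decomp: "proj_perp u x + (x \<bullet> u) *\<^sub>R u = x"
  by (simp add: proj_perp_def)

lemma norm_add_orthogonal_unit:
  "norm u = 1 \<Longrightarrow> p \<bullet> u = 0 \<Longrightarrow> (norm (p + t *\<^sub>R u))\<^sup>2 = (norm p)\<^sup>2 + t\<^sup>2"
  by (simp add: power2_norm_eq_inner inner_add inner_commute norm_eq_1 flip: power2_eq_square)

lemma norm_proj_perp_le:
  assumes "norm u = 1"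
  shows "norm (proj_perp u x) \<le> norm x"
proof -
  have "(norm x)\<^sup>2 = (norm (proj_perp u x))\<^sup>2 + (x \<bullet> u)\<^sup>2"
    using norm_add_orthogonal_unit[OF assms proj_perp_orthogonal[OF assms], of x "x \<bullet> u"]
    by (simp add: proj_perp_decomp)
  then have "(norm (proj_perp u x))\<^sup>2 \<le> (norm x)\<^sup>2" by simp
  then show ?thesis by (rule power2_le_imp_le) simp
qed

lemma proj_perp_image_iff:
  assumes "norm u = 1"
  shows "p \<in> proj_perp u ` K \<longleftrightarrow> p \<bullet> u = 0 \<and> (\<exists>t. p + t *\<^sub>R u \<in> K)"
proof
  assume "p \<in> proj_perp u ` K"
  then obtain k where k: "k \<in> K" "p = proj_perp u k" by blast
  then have "p + (k \<bullet> u) *\<^sub>R u \<in> K" by (simp add: proj_perp_decomp)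
  then show "p \<bullet> u = 0 \<and> (\<exists>t. p + t *\<^sub>R u \<in> K)"
    using k(2) proj_perp_orthogonal[OF assms] by blast
next
  assume "p \<bullet> u = 0 \<and> (\<exists>t. p + t *\<^sub>R u \<in> K)"
  then obtain t where "p \<bullet> u = 0" "p + t *\<^sub>R u \<in> K" by blast
  then show "p \<in> proj_perp u ` K"
    by (intro image_eqI[of _ _ "p + t *\<^sub>R u"]) (simp_all add: proj_perp_plus assms)
qed

section \<open>Line sections and chord lengths\<close>

lemma bounded_line_section:
  fixes u :: "'a::euclidean_space"
  assumes "norm u = 1" "bounded K"
  shows "bounded {t. p + t *\<^sub>R u \<in> K}"
proof -
  obtain B where B: "\<And>x. x \<in> K \<Longrightarrow> norm x \<le> B" using assms(2) bounded_iff by metis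
  have "norm t \<le> B + norm p" if "p + t *\<^sub>R u \<in> K" for t
    using B[OF that] norm_triangle_ineq4[of "p + t *\<^sub>R u" p] assms(1) by simp
  then show ?thesis unfolding bounded_iff by blast
qed

lemma chord_length_ge:
  assumes "norm u = 1" "bounded K" "p + a *\<^sub>R u \<in> K" "p + b *\<^sub>R u \<in> K"
  shows "a - b \<le> chord_length K u p"
proof -
  note bounded_line_section[OF assms(1,2), of p]
  then have "bdd_above {t. p + t *\<^sub>R u \<in> K}" "bdd_below {t. p + t *\<^sub>R u \<in> K}"
    by (simp_all add: bounded_imp_bdd_above bounded_imp_bdd_below)
  then have "a \<le> Sup {t. p + t *\<^sub>R u \<in> K}" "Inf {t. p + t *\<^sub>R u \<in> K} \<le> b"
    using assms(3,4) by (auto intro: cSup_upper cInf_lower)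
  then show ?thesis unfolding chord_length_def by linarith
qed

text \<open>Together with \<open>chord_length_ge\<close> this describes the chord length as the
  least upper bound of parameter differences. All later arguments use these two bounds in place of
  \<open>Sup\<close> and \<open>Inf\<close>.\<close>

lemma chord_length_le:
  assumes "p + t *\<^sub>R u \<in> K"
    and "\<And>a b. p + a *\<^sub>R u \<in> K \<Longrightarrow> p + b *\<^sub>R u \<in> K \<Longrightarrow> a - b \<le> c"
  shows "chord_length K u p \<le> c"
proof -
  let ?A = "{t. p + t *\<^sub>R u \<in> K}"
  have ne: "?A \<noteq> {}" using assms(1) by blast
  have "Sup ?A \<le> c + b" if "b \<in> ?A" for b
    using ne assms(2) that by (intro cSup_least) (auto simp: algebra_simps)
  then have "Sup ?A - c \<le> Inf ?A"
    using ne by (intro cInf_greatest) (auto simp: algebra_simps)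
  then show ?thesis unfolding chord_length_def by linarith
qed

section \<open>Membership, balls and convexity under one symmetrization\<close>

lemma steiner_iff:
  assumes "norm u = 1"
  shows "y \<in> steiner u K \<longleftrightarrow>
    proj_perp u y \<in> proj_perp u ` K \<and> \<bar>y \<bullet> u\<bar> \<le> chord_length K u (proj_perp u y) / 2"
proof
  assume "y \<in> steiner u K"
  then obtain x t where *: "y = x + t *\<^sub>R u" "x \<in> proj_perp u ` K" "\<bar>t\<bar> \<le> chord_length K u x / 2"
    unfolding steiner_def by blast
  then have "x \<bullet> u = 0" using proj_perp_image_iff[OF assms] by blast
  then have "proj_perp u y = x" "y \<bullet> u = t"
    using * assms by (simp_all add: proj_perp_plus inner_add_left norm_eq_1)
  then show "proj_perp u y \<in> proj_perp u ` K \<and> \<bar>y \<bullet> u\<bar> \<le> chord_length K u (proj_perp u y) / 2"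
    using * by simp
next
  assume "proj_perp u y \<in> proj_perp u ` K \<and> \<bar>y \<bullet> u\<bar> \<le> chord_length K u (proj_perp u y) / 2"
  then show "y \<in> steiner u K"
    unfolding steiner_def using proj_perp_decomp[of u y] by force
qed

text \<open>By Pythagoras, the section of \<open>K\<close> over \<open>p\<close> has parameters of
  absolute value at most h, the square root of \<open>R\<^sup>2 - (norm p)\<^sup>2\<close>. So half
  its chord length is at most h, and a new point over \<open>p\<close> stays in the ball.\<close>

lemma steiner_subset_cball:
  assumes u: "norm u = 1" and K: "K \<subseteq> cball 0 R"
  shows "steiner u K \<subseteq> cball 0 R"
proof
  fix y assume "y \<in> steiner u K"
  define p where "p = proj_perp u y"
  have y: "p \<in> proj_perp u ` K" "\<bar>y \<bullet> u\<bar> \<le> chord_length K u p / 2"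
    using steiner_iff[OF u] \<open>y \<in> steiner u K\<close> unfolding p_def by auto
  then obtain t where pu: "p \<bullet> u = 0" and t: "p + t *\<^sub>R u \<in> K"
    using proj_perp_image_iff[OF u] by blast
  have R: "0 \<le> R" using t K by (metis mem_cball_0 norm_ge_zero order_trans subsetD)
  have sec: "(norm p)\<^sup>2 + a\<^sup>2 \<le> R\<^sup>2" if "p + a *\<^sub>R u \<in> K" for a
    using that K norm_add_orthogonal_unit[OF u pu] by (metis mem_cball_0 norm_ge_zero power_mono subsetD)
  have "\<bar>a\<bar> \<le> sqrt (R\<^sup>2 - (norm p)\<^sup>2)" if "p + a *\<^sub>R u \<in> K" for a
    using sec[OF that] by (intro real_le_rsqrt) simp
  then have "chord_length K u p \<le> 2 * sqrt (R\<^sup>2 - (norm p)\<^sup>2)"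
    by (intro chord_length_le[OF t]) (smt (verit))
  then have "\<bar>y \<bullet> u\<bar> \<le> sqrt (R\<^sup>2 - (norm p)\<^sup>2)" using y by simp
  moreover have "0 \<le> R\<^sup>2 - (norm p)\<^sup>2" using sec[OF t] by (smt (verit) zero_le_power2)
  ultimately have "(y \<bullet> u)\<^sup>2 \<le> R\<^sup>2 - (norm p)\<^sup>2"
    using power_mono[of "\<bar>y \<bullet> u\<bar>" _ 2] by fastforce
  then have "(norm y)\<^sup>2 \<le> R\<^sup>2"
    using norm_add_orthogonal_unit[OF u pu, of "y \<bullet> u"] unfolding p_def by (simp add: proj_perp_decomp)
  then show "y \<in> cball 0 R" using power2_le_imp_le[OF _ R] by simp
qed

text \<open>A point at height \<open>s\<close> over the projected centre comes from two points of
  the original ball, at heights \<open>s\<close> and \<open>-s\<close> relative to \<open>x\<close>.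
  They lie on one chord of \<open>K\<close>, which therefore has length at least twice the absolute
  value of \<open>s\<close>.\<close>

lemma cball_subset_steiner:
  assumes u: "norm u = 1" and K: "bounded K" and ball: "cball x r \<subseteq> K"
  shows "cball (proj_perp u x) r \<subseteq> steiner u K"
proof
  fix y assume "y \<in> cball (proj_perp u x) r"
  then have yr: "norm (y - proj_perp u x) \<le> r" by (simp add: dist_norm norm_minus_commute)
  define p where "p = proj_perp u y"
  define s where "s = y \<bullet> u"
  define q where "q = p - proj_perp u x"
  have qu: "q \<bullet> u = 0"
    using proj_perp_orthogonal[OF u] unfolding q_def p_def by (simp add: inner_diff_left)
  have "y - proj_perp u x = q + s *\<^sub>R u"
    unfolding q_def p_def s_def proj_perp_def by simp
  then have n: "norm (q + s *\<^sub>R u) \<le> r" using yr by simp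
  \<comment> \<open>Reflection in the hyperplane orthogonal to \<open>u\<close> preserves the
    norm.\<close>
  have n': "norm (q + a *\<^sub>R u) \<le> r" if "\<bar>a\<bar> = \<bar>s\<bar>" for a
  proof -
    have "a\<^sup>2 = s\<^sup>2" using that by (metis power2_abs)
    then have "(norm (q + a *\<^sub>R u))\<^sup>2 = (norm (q + s *\<^sub>R u))\<^sup>2"
      by (simp add: norm_add_orthogonal_unit[OF u qu])
    then show ?thesis using n by (simp add: power2_eq_iff_nonneg)
  qed
  have mem: "p + (x \<bullet> u + a) *\<^sub>R u \<in> K" if "\<bar>a\<bar> = \<bar>s\<bar>" for a
  proof -
    have "p + (x \<bullet> u + a) *\<^sub>R u = x + (q + a *\<^sub>R u)"
      unfolding q_def proj_perp_def[of u x] by (simp add: algebra_simps)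
    then have "dist x (p + (x \<bullet> u + a) *\<^sub>R u) \<le> r"
      using n'[OF that] by (metis dist_add_cancel add_0_right dist_0_norm)
    then show ?thesis using ball by auto
  qed
  have "2 * \<bar>s\<bar> \<le> chord_length K u p"
    using chord_length_ge[OF u K mem mem, of "\<bar>s\<bar>" "- \<bar>s\<bar>"] by simp
  moreover have "p \<in> proj_perp u ` K"
    using proj_perp_image_iff[OF u] mem[of s] proj_perp_orthogonal[OF u] unfolding p_def by blast
  ultimately show "y \<in> steiner u K"
    using steiner_iff[OF u] unfolding p_def s_def by simp
qed

text \<open>The chord length is a concave function on the projection of \<open>K\<close>: convex
  combinations of points on the chords over \<open>p\<close> and \<open>q\<close> lie on the chord
  over \<open>m\<close>. Convexity of the iterates is what later permits
  \<open>near_imp_dilated_in\<close>.\<close>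

lemma convex_steiner:
  assumes u: "norm u = 1" and bK: "bounded K" and K: "convex K"
  shows "convex (steiner u K)"
proof (rule convexI)
  fix y z :: 'a and v w :: real
  assume y: "y \<in> steiner u K" and z: "z \<in> steiner u K" and vw: "0 \<le> v" "0 \<le> w" "v + w = 1"
  define p q where "p = proj_perp u y" and "q = proj_perp u z"
  define m where "m = v *\<^sub>R p + w *\<^sub>R q"
  have Y: "p \<in> proj_perp u ` K" "\<bar>y \<bullet> u\<bar> \<le> chord_length K u p / 2"
    using steiner_iff[OF u] y unfolding p_def by auto
  have Z: "q \<in> proj_perp u ` K" "\<bar>z \<bullet> u\<bar> \<le> chord_length K u q / 2"
    using steiner_iff[OF u] z unfolding q_def by auto
  obtain tp where tp: "p + tp *\<^sub>R u \<in> K"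
    using Y(1) proj_perp_image_iff[OF u] by blast
  obtain tq where tq: "q + tq *\<^sub>R u \<in> K"
    using Z(1) proj_perp_image_iff[OF u] by blast
  have m: "proj_perp u (v *\<^sub>R y + w *\<^sub>R z) = m"
    unfolding m_def p_def q_def using linear_proj_perp[of u] by (simp add: linear_add linear_scale)
  have comb: "m + (v * a + w * b) *\<^sub>R u \<in> K" if "p + a *\<^sub>R u \<in> K" "q + b *\<^sub>R u \<in> K" for a b
    using convexD[OF K that vw] unfolding m_def by (simp add: algebra_simps)
  have "v * chord_length K u p + w * chord_length K u q \<le> chord_length K u m"
  proof (cases "v = 0 \<or> w = 0")
    case True
    then show ?thesis using vw unfolding m_def by auto
  next
    case False
    then have pos: "0 < v" "0 < w" using vw by auto
    \<comment> \<open>The two chords are optimized one after the other: first over \<open>a\<close>,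
      \<open>b\<close> on the chord at \<open>p\<close> with \<open>c\<close>, \<open>d\<close>
      fixed, then over \<open>c\<close>, \<open>d\<close>. Positive weights allow the divisions that
      bring the bounds into the form of \<open>chord_length_le\<close>.\<close>
    have "w * (c - d) \<le> chord_length K u m - v * chord_length K u p"
      if c: "q + c *\<^sub>R u \<in> K" and d: "q + d *\<^sub>R u \<in> K" for c d
    proof -
      have "a - b \<le> (chord_length K u m - w * (c - d)) / v"
        if a: "p + a *\<^sub>R u \<in> K" and b: "p + b *\<^sub>R u \<in> K" for a b
        using chord_length_ge[OF u bK comb[OF a c] comb[OF b d]] pos by (simp add: field_simps)
      then have "chord_length K u p \<le> (chord_length K u m - w * (c - d)) / v"
        by (rule chord_length_le[OF tp])
      then show ?thesis using pos by (simp add: field_simps)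
    qed
    then have "chord_length K u q \<le> (chord_length K u m - v * chord_length K u p) / w"
      using pos by (intro chord_length_le[OF tq]) (simp add: field_simps)
    then show ?thesis using pos by (simp add: field_simps)
  qed
  moreover have "\<bar>v * (y \<bullet> u) + w * (z \<bullet> u)\<bar> \<le> v * \<bar>y \<bullet> u\<bar> + w * \<bar>z \<bullet> u\<bar>"
    using vw abs_triangle_ineq[of "v * (y \<bullet> u)" "w * (z \<bullet> u)"] by (simp add: abs_mult)
  moreover have "v * \<bar>y \<bullet> u\<bar> \<le> v * (chord_length K u p / 2)" "w * \<bar>z \<bullet> u\<bar> \<le> w * (chord_length K u q / 2)"
    by (rule mult_left_mono[OF Y(2) vw(1)], rule mult_left_mono[OF Z(2) vw(2)])
  ultimately have "\<bar>(v *\<^sub>R y + w *\<^sub>R z) \<bullet> u\<bar> \<le> chord_length K u m / 2"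
    by (simp add: inner_add_left)
  moreover have "m \<in> proj_perp u ` K"
  proof -
    have "m \<bullet> u = 0"
      unfolding m[symmetric] by (rule proj_perp_orthogonal[OF u])
    then show ?thesis using proj_perp_image_iff[OF u] comb[OF tp tq] by blast
  qed
  ultimately show "v *\<^sub>R y + w *\<^sub>R z \<in> steiner u K"
    using steiner_iff[OF u] m by simp
qed

text \<open>The homothety acts on the left-hand set. For positive \<open>c\<close> this means that
  \<open>L\<close> lies in the dilate of \<open>M\<close> about \<open>x\<close> with ratio
  \<open>1 / c\<close>; it is used with \<open>c\<close> slightly below 1.\<close>

definition dilated_in :: "'a::real_vector \<Rightarrow> real \<Rightarrow> 'a set \<Rightarrow> 'a set \<Rightarrow> bool" where
  "dilated_in x c L M \<longleftrightarrow> (\<forall>y\<in>L. x + c *\<^sub>R (y - x) \<in> M)"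

text \<open>The homothety carries the chord of \<open>L\<close> over \<open>p\<close> into the chord
  of \<open>M\<close> over \<open>q\<close> and multiplies parameter differences by
  \<open>c\<close>. Symmetrization recentres both chords at height 0, so the new homothety has its
  centre at the projection of \<open>x\<close>.\<close>

lemma dilated_in_steiner:
  assumes u: "norm u = 1" and M: "bounded M" and c: "0 < c" and dil: "dilated_in x c L M"
  shows "dilated_in (proj_perp u x) c (steiner u L) (steiner u M)"
  unfolding dilated_in_def
proof
  fix y assume "y \<in> steiner u L"
  define x' p where "x' = proj_perp u x" and "p = proj_perp u y"
  define q where "q = x' + c *\<^sub>R (p - x')"
  have y: "p \<in> proj_perp u ` L" "\<bar>y \<bullet> u\<bar> \<le> chord_length L u p / 2"
    using steiner_iff[OF u] \<open>y \<in> steiner u L\<close> unfolding p_def by auto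
  then obtain t where t: "p + t *\<^sub>R u \<in> L"
    using proj_perp_image_iff[OF u] by blast
  have ort: "x' \<bullet> u = 0" "p \<bullet> u = 0"
    unfolding x'_def p_def using proj_perp_orthogonal[OF u] by auto
  then have qu: "q \<bullet> u = 0"
    unfolding q_def by (simp add: inner_add_left inner_diff_left)
  \<comment> \<open>The offset depending on \<open>x \<bullet> u\<close> is the same for all points
    of the chord, so it cancels in differences.\<close>
  have mem: "q + (x \<bullet> u + c * (a - x \<bullet> u)) *\<^sub>R u \<in> M" if "p + a *\<^sub>R u \<in> L" for a
  proof -
    have "x + c *\<^sub>R (p + a *\<^sub>R u - x) \<in> M" using dil that unfolding dilated_in_def by blast
    moreover have "x + c *\<^sub>R (p + a *\<^sub>R u - x) = q + (x \<bullet> u + c * (a - x \<bullet> u)) *\<^sub>R u"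
      unfolding q_def x'_def proj_perp_def by (simp add: algebra_simps)
    ultimately show ?thesis by simp
  qed
  have "a - b \<le> chord_length M u q / c" if "p + a *\<^sub>R u \<in> L" "p + b *\<^sub>R u \<in> L" for a b
    using chord_length_ge[OF u M mem[OF that(1)] mem[OF that(2)]] c by (simp add: field_simps)
  then have "chord_length L u p \<le> chord_length M u q / c"
    by (rule chord_length_le[OF t])
  then have "\<bar>y \<bullet> u\<bar> \<le> chord_length M u q / c / 2"
    using y(2) by (meson divide_right_mono order_trans zero_le_numeral)
  then have "\<bar>c * (y \<bullet> u)\<bar> \<le> chord_length M u q / 2"
    using c by (simp add: abs_mult field_simps)
  moreover have "(x' + c *\<^sub>R (y - x')) \<bullet> u = c * (y \<bullet> u)"
    using ort by (simp add: inner_add_left inner_diff_left)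
  moreover have "proj_perp u (x' + c *\<^sub>R (y - x')) = q"
  proof -
    have "proj_perp u x' = x'" using proj_perp_plus[OF u ort(1), of 0] by simp
    then show ?thesis
      unfolding q_def p_def using linear_proj_perp[of u]
      by (simp add: linear_add linear_scale linear_diff)
  qed
  moreover have "q \<in> proj_perp u ` M"
    using proj_perp_image_iff[OF u] qu mem[OF t] by blast
  ultimately show "proj_perp u x + c *\<^sub>R (y - proj_perp u x) \<in> steiner u M"
    using steiner_iff[OF u] unfolding x'_def by simp
qed

text \<open>An error vector of length at most \<open>d\<close>, magnified by \<open>r / d\<close>,
  still fits into the ball. Averaging the resulting point of \<open>K\<close> with \<open>k\<close>,
  with weights proportional to \<open>d\<close> and \<open>r\<close>, absorbs the error by
  convexity.\<close>

lemma near_imp_dilated_in: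
  fixes K :: "'a::euclidean_space set"
  assumes K: "convex K" and ball: "cball x r \<subseteq> K" and r: "0 < r" and d: "0 < d"
    and near: "\<And>l. l \<in> L \<Longrightarrow> \<exists>k\<in>K. dist l k \<le> d"
  shows "dilated_in x (r / (r + d)) L K"
  unfolding dilated_in_def
proof
  fix l assume "l \<in> L"
  then obtain k where k: "k \<in> K" "dist l k \<le> d" using near by blast
  define b where "b = x + (r / d) *\<^sub>R (l - k)"
  have "norm ((r / d) *\<^sub>R (l - k)) = r * (dist l k / d)" using r d by (simp add: dist_norm)
  also have "\<dots> \<le> r * 1" using k r d by (intro mult_left_mono) auto
  finally have "b \<in> K" using ball unfolding b_def by (auto simp: dist_norm)
  moreover have "r / (r + d) + d / (r + d) = 1" using r d by (simp flip: add_divide_distrib)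
  ultimately have "(r / (r + d)) *\<^sub>R k + (d / (r + d)) *\<^sub>R b \<in> K"
    using K k r d by (intro convexD) auto
  moreover have "(r / (r + d)) *\<^sub>R k + (d / (r + d)) *\<^sub>R b = x + (r / (r + d)) *\<^sub>R (l - x)"
  proof -
    have "(d / (r + d)) *\<^sub>R b = (1 - r / (r + d)) *\<^sub>R x + (r / (r + d)) *\<^sub>R (l - k)"
      \<comment> \<open>With c denoting \<open>r / (r + d)\<close>, the weight
        \<open>d / (r + d)\<close> is 1 - c, and its product with \<open>r / d\<close> is c.\<close>
      unfolding b_def using r d by (simp add: scaleR_add_right field_simps)
    then show ?thesis by (simp add: algebra_simps)
  qed
  ultimately show "x + (r / (r + d)) *\<^sub>R (l - x) \<in> K" by simp
qed

section \<open>Steiner processes\<close>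

text \<open>These points depend only on \<open>x\<close> and the directions, not on the body, so the
  same centres serve the processes of \<open>K\<close> and of \<open>L\<close>.\<close>

primrec proj_seq :: "(nat \<Rightarrow> 'a::euclidean_space) \<Rightarrow> 'a \<Rightarrow> nat \<Rightarrow> 'a" where
  "proj_seq \<alpha> x 0 = x"
| "proj_seq \<alpha> x (Suc i) = proj_perp (\<alpha> i) (proj_seq \<alpha> x i)"

lemma norm_proj_seq_le:
  assumes "\<And>i. norm (\<alpha> i) = 1"
  shows "norm (proj_seq \<alpha> x i) \<le> norm x"
proof (induction i)
  case (Suc i)
  then show ?case using norm_proj_perp_le[OF assms, of i] by (simp add: order_trans[OF _ Suc])
qed simp

lemma steiner_seq_subset_cball:
  "(\<And>i. norm (\<alpha> i) = 1) \<Longrightarrow> K \<subseteq> cball 0 R \<Longrightarrow> steiner_seq \<alpha> K i \<subseteq> cball 0 R"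
  by (induction i) (simp_all add: steiner_subset_cball)

lemma bounded_steiner_seq:
  assumes "\<And>i. norm (\<alpha> i) = 1" "bounded K"
  shows "bounded (steiner_seq \<alpha> K i)"
proof -
  obtain R where "K \<subseteq> cball 0 R" using bounded_subset_ballD[OF assms(2), of 0] ball_subset_cball by blast
  then have "steiner_seq \<alpha> K i \<subseteq> cball 0 R" by (rule steiner_seq_subset_cball[of \<alpha>, OF assms(1)])
  then show ?thesis using bounded_subset bounded_cball by blast
qed

lemma steiner_seq_nonempty:
  assumes \<alpha>: "\<And>i. norm (\<alpha> i) = 1" and K: "bounded K" "K \<noteq> {}"
  shows "steiner_seq \<alpha> K i \<noteq> {}"
proof (induction i)
  case (Suc i)
  then obtain y where y: "y \<in> steiner_seq \<alpha> K i" by blast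
  then have *: "proj_perp (\<alpha> i) y + (y \<bullet> \<alpha> i) *\<^sub>R \<alpha> i \<in> steiner_seq \<alpha> K i"
    by (simp add: proj_perp_decomp)
  have "0 \<le> chord_length (steiner_seq \<alpha> K i) (\<alpha> i) (proj_perp (\<alpha> i) y)"
    using chord_length_ge[OF \<alpha> bounded_steiner_seq[of \<alpha>, OF \<alpha> K(1)] * *] by simp
  \<comment> \<open>The foot of \<open>y\<close> is the midpoint of its symmetrized chord; it
    belongs to the new set because the chord length is nonnegative.\<close>
  then have "proj_perp (\<alpha> i) y + 0 *\<^sub>R \<alpha> i \<in> steiner_seq \<alpha> K (Suc i)"
    unfolding steiner_seq.simps steiner_def using y by fastforce
  then show ?case by blast
qed (use K in simp)

lemma convex_steiner_seq:
  "(\<And>i. norm (\<alpha> i) = 1) \<Longrightarrow> bounded K \<Longrightarrow> convex K \<Longrightarrow> convex (steiner_seq \<alpha> K i)"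
  by (induction i) (simp_all add: convex_steiner bounded_steiner_seq)

lemma cball_proj_seq_subset:
  "(\<And>i. norm (\<alpha> i) = 1) \<Longrightarrow> bounded K \<Longrightarrow> cball x r \<subseteq> K \<Longrightarrow>
    cball (proj_seq \<alpha> x i) r \<subseteq> steiner_seq \<alpha> K i"
  by (induction i) (simp_all add: cball_subset_steiner bounded_steiner_seq)

lemma dilated_in_steiner_seq:
  assumes "\<And>i. norm (\<alpha> i) = 1" "bounded M" "0 < c" "i \<le> j"
    and "dilated_in (proj_seq \<alpha> x i) c (steiner_seq \<alpha> L i) (steiner_seq \<alpha> M i)"
  shows "dilated_in (proj_seq \<alpha> x j) c (steiner_seq \<alpha> L j) (steiner_seq \<alpha> M j)"
  using assms(4)
  by (induction j rule: dec_induct) (simp_all add: assms dilated_in_steiner bounded_steiner_seq)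

text \<open>Closeness at a single index does not obviously propagate, but the dilated inclusion it
  yields does. At later indices the homothety moves points of the bounded sets only slightly, which
  turns the inclusion back into closeness.\<close>

lemma steiner_seq_eventually_close:
  fixes \<alpha> :: "nat \<Rightarrow> 'a::euclidean_space"
  assumes \<alpha>: "\<And>i. norm (\<alpha> i) = 1" and K: "bounded K" "convex K" "cball x r \<subseteq> K" and r: "0 < r"
    and L: "bounded L"
    and near: "\<And>d. 0 < d \<Longrightarrow>
      \<exists>i. \<forall>l\<in>steiner_seq \<alpha> L i. \<exists>k\<in>steiner_seq \<alpha> K i. dist l k \<le> d"
    and e: "0 < e"
  shows "\<exists>N. \<forall>j\<ge>N. \<forall>l\<in>steiner_seq \<alpha> L j. infdist l (steiner_seq \<alpha> K j) \<le> e"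
proof -
  obtain R where R: "0 < R" "L \<subseteq> cball 0 R"
    using bounded_subset_ballD[OF L, of 0] subset_trans[OF _ ball_subset_cball] by metis
  \<comment> \<open>\<open>C\<close> bounds the distance from any point of any iterate of
    \<open>L\<close> to the current centre: centres have norm at most \<open>norm x\<close>, and the
    iterates stay in the ball of radius \<open>R\<close>.\<close>
  define C where "C = norm x + R"
  have C: "0 < C" unfolding C_def using R by (simp add: add_nonneg_pos)
  \<comment> \<open>Chosen so that \<open>d / r * C = e\<close>; the displacement is at most
    \<open>(1 - c) * C\<close>, and \<open>1 - c\<close> is at most \<open>d / r\<close>.\<close>
  define d where "d = e * r / C"
  have d: "0 < d" unfolding d_def using e r C by simp
  define c where "c = r / (r + d)"
  have c: "0 < c" "1 - c = d / (r + d)" unfolding c_def using r d by (auto simp: field_simps)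
  obtain i where i: "\<forall>l\<in>steiner_seq \<alpha> L i. \<exists>k\<in>steiner_seq \<alpha> K i. dist l k \<le> d"
    using near[OF d] by blast
  have "dilated_in (proj_seq \<alpha> x i) c (steiner_seq \<alpha> L i) (steiner_seq \<alpha> K i)"
    unfolding c_def using i r d convex_steiner_seq[of \<alpha>, OF \<alpha>] cball_proj_seq_subset[of \<alpha>, OF \<alpha>] K
    by (intro near_imp_dilated_in) auto
  then have dil: "dilated_in (proj_seq \<alpha> x j) c (steiner_seq \<alpha> L j) (steiner_seq \<alpha> K j)" if "i \<le> j" for j
    using dilated_in_steiner_seq[of \<alpha>, OF \<alpha> K(1) c(1) that] by blast
  have "infdist l (steiner_seq \<alpha> K j) \<le> e" if j: "j \<ge> i" and l: "l \<in> steiner_seq \<alpha> L j" for j l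
  proof -
    define z where "z = proj_seq \<alpha> x j"
    have "l \<in> cball 0 R" using steiner_seq_subset_cball[of \<alpha>, OF \<alpha> R(2)] l by blast
    then have "norm (l - z) \<le> C"
      using norm_proj_seq_le[of \<alpha> x j, OF \<alpha>] norm_triangle_ineq4[of l z] unfolding C_def z_def by simp
    moreover have "1 - c \<le> d / r"
      unfolding c using r d by (intro divide_left_mono) auto
    moreover have "0 \<le> d / r" using r d by simp
    ultimately have "(1 - c) * norm (l - z) \<le> d / r * C"
      by (intro mult_mono) auto
    also have "\<dots> = e" unfolding d_def using r C by simp
    finally have le: "(1 - c) * norm (l - z) \<le> e" .
    have "l - (z + c *\<^sub>R (l - z)) = (1 - c) *\<^sub>R (l - z)" by (simp add: algebra_simps)
    moreover have "0 \<le> 1 - c" unfolding c using r d by simp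
    ultimately have "dist l (z + c *\<^sub>R (l - z)) \<le> e" using le by (simp add: dist_norm)
    moreover have "z + c *\<^sub>R (l - z) \<in> steiner_seq \<alpha> K j"
      using dil[OF j] l unfolding z_def dilated_in_def by blast
    ultimately show ?thesis by (rule infdist_le2[rotated])
  qed
  then show ?thesis by blast
qed

text \<open>Two subsequences play different roles. Along \<open>s\<close> the iterates of
  \<open>K\<close> and of \<open>L\<close> both approach \<open>L\<close>, which provides the
  initial closeness. Along \<open>t\<close> the iterates of \<open>L\<close> still approach
  \<open>L\<close> while those of \<open>K\<close> approach \<open>M\<close>.\<close>

lemma steiner_subseq_limit_subset:
  fixes \<alpha> :: "nat \<Rightarrow> 'a::euclidean_space"
  assumes \<alpha>: "\<And>i. norm (\<alpha> i) = 1" and K: "bounded K" "convex K" "cball x r \<subseteq> K" and r: "0 < r"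
    and L: "steiner_subseq_limit \<alpha> K L" "steiner_limit \<alpha> L L" and M: "steiner_subseq_limit \<alpha> K M"
  shows "L \<subseteq> M"
proof
  let ?K = "steiner_seq \<alpha> K" and ?L = "steiner_seq \<alpha> L"
  have cL: "compact L" "L \<noteq> {}" and limL: "(\<lambda>i. hausdist (?L i) L) \<longlonglongrightarrow> 0"
    using L(2) unfolding steiner_limit_def by auto
  obtain s where s: "strict_mono s" "(\<lambda>i. hausdist (?K (s i)) L) \<longlonglongrightarrow> 0"
    using L(1) unfolding steiner_subseq_limit_def by blast
  have cM: "compact M" "M \<noteq> {}" using M unfolding steiner_subseq_limit_def by auto
  obtain t where t: "strict_mono t" "(\<lambda>i. hausdist (?K (t i)) M) \<longlonglongrightarrow> 0"
    using M unfolding steiner_subseq_limit_def by blast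
  have bK: "bounded (?K i)" for i using bounded_steiner_seq[of \<alpha>, OF \<alpha> K(1)] .
  have bL: "bounded (?L i)" for i using bounded_steiner_seq[of \<alpha>, OF \<alpha> compact_imp_bounded[OF cL(1)]] .
  have neK: "?K i \<noteq> {}" for i
    using steiner_seq_nonempty[of \<alpha>, OF \<alpha> K(1)] K(3) r by fastforce
  have near: "\<exists>i. \<forall>l\<in>?L i. \<exists>k\<in>?K i. dist l k \<le> d" if d: "0 < d" for d
  proof -
    have "\<forall>\<^sub>F i in sequentially. hausdist (?K (s i)) L < d / 2"
      using order_tendstoD(2)[OF s(2), of "d / 2"] d by simp
    moreover have "\<forall>\<^sub>F i in sequentially. hausdist (?L (s i)) L < d / 2"
      using order_tendstoD(2)[OF LIMSEQ_subseq_LIMSEQ[OF limL s(1)], of "d / 2"] d by (simp add: o_def)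
    ultimately have "\<forall>\<^sub>F i in sequentially. hausdist (?K (s i)) L < d / 2 \<and> hausdist (?L (s i)) L < d / 2"
      by (rule eventually_conj)
    then obtain n where n: "hausdist (?K (s n)) L < d / 2" "hausdist (?L (s n)) L < d / 2"
      using eventually_happens'[OF sequentially_bot] by fast
    have "\<exists>k\<in>?K (s n). dist l k \<le> d" if l: "l \<in> ?L (s n)" for l
    proof -
      have "infdist l L < d / 2" using infdist_le_hausdist[OF bL l] n le_less_trans by blast
      then obtain y where y: "y \<in> L" "dist l y < d / 2"
        using infdist_less_imp_dist_less cL by blast
      have "infdist y (?K (s n)) < d / 2"
        using infdist_le_hausdist[OF compact_imp_bounded[OF cL(1)] y(1)] n hausdist_commute le_less_trans
        by metis
      then obtain k where k: "k \<in> ?K (s n)" "dist y k < d / 2"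
        using infdist_less_imp_dist_less neK by blast
      then show ?thesis using y dist_triangle_half_r[of y l d k] by (auto simp: dist_commute intro: less_imp_le)
    qed
    then show ?thesis by blast
  qed
  fix l assume l: "l \<in> L"
  have "infdist l M \<le> 0"
  proof (rule field_le_epsilon)
    fix e :: real assume "0 < e"
    \<comment> \<open>The chain from \<open>l\<close> through \<open>y\<close> and \<open>k\<close>
      to \<open>M\<close> costs \<open>d\<close>, \<open>2 * d\<close> and \<open>d\<close>.\<close>
    define d where "d = e / 4"
    have d: "0 < d" using \<open>0 < e\<close> unfolding d_def by simp
    obtain N where N: "\<And>j l. j \<ge> N \<Longrightarrow> l \<in> ?L j \<Longrightarrow> infdist l (?K j) \<le> d"
      using steiner_seq_eventually_close[of \<alpha>, OF \<alpha> K r compact_imp_bounded[OF cL(1)] near d] by blast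
    have "\<forall>\<^sub>F i in sequentially. hausdist (?K (t i)) M < d"
      using order_tendstoD(2)[OF t(2)] d by simp
    moreover have "\<forall>\<^sub>F i in sequentially. hausdist (?L (t i)) L < d"
      using order_tendstoD(2)[OF LIMSEQ_subseq_LIMSEQ[OF limL t(1)]] d by (simp add: o_def)
    moreover have "\<forall>\<^sub>F i in sequentially. N \<le> t i"
      using t(1) by (meson eventually_sequentiallyI order_trans seq_suble)
    ultimately have "\<forall>\<^sub>F i in sequentially. hausdist (?K (t i)) M < d \<and> hausdist (?L (t i)) L < d \<and> N \<le> t i"
      by eventually_elim auto
    then obtain n where n: "hausdist (?K (t n)) M < d" "hausdist (?L (t n)) L < d" "N \<le> t n"
      using eventually_happens'[OF sequentially_bot] by fast
    have neL: "?L (t n) \<noteq> {}"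
      using steiner_seq_nonempty[of \<alpha>, OF \<alpha> compact_imp_bounded[OF cL(1)] cL(2)] .
    have "infdist l (?L (t n)) < d"
      using infdist_le_hausdist[OF compact_imp_bounded[OF cL(1)] l] n hausdist_commute le_less_trans by metis
    then obtain y where y: "y \<in> ?L (t n)" "dist l y < d"
      using infdist_less_imp_dist_less neL by blast
    \<comment> \<open>Passing from \<open>d\<close> to \<open>2 * d\<close> gives a strict bound,
      from which an actual point \<open>k\<close> can be extracted.\<close>
    have "infdist y (?K (t n)) < 2 * d" using N[OF n(3) y(1)] d by simp
    then obtain k where k: "k \<in> ?K (t n)" "dist y k < 2 * d"
      using infdist_less_imp_dist_less neK by blast
    have "infdist k M < d" using infdist_le_hausdist[OF bK k(1)] n le_less_trans by blast
    then show "infdist l M \<le> 0 + e"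
      using y k infdist_triangle[of l M k] dist_triangle[of l k y] unfolding d_def by linarith
  qed
  then have "infdist l M = 0" using infdist_nonneg[of l M] by linarith
  then show "l \<in> M"
    using in_closed_iff_infdist_zero[OF compact_imp_closed[OF cM(1)] cM(2)] by blast
qed

theorem theorem4p6:
  fixes K :: "'a::euclidean_space set" and \<alpha> :: "nat \<Rightarrow> 'a"
  assumes "compact K" and "convex K" and "interior K \<noteq> {}"
    and "\<And>i. norm (\<alpha> i) = 1"
    and "\<And>L. steiner_subseq_limit \<alpha> K L \<Longrightarrow> steiner_limit \<alpha> L L"
  shows "\<exists>L. steiner_limit \<alpha> K L"
proof -
  let ?K = "steiner_seq \<alpha> K"
  have bK: "bounded K" using assms(1) compact_imp_bounded by blast
  obtain x r where r: "0 < r" "cball x r \<subseteq> K"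
    using assms(3) mem_interior_cball by blast
  obtain R where R: "K \<subseteq> cball 0 R"
    using bounded_subset_ballD[OF bK, of 0] ball_subset_cball by blast
  have sub: "?K i \<subseteq> cball 0 R" for i using steiner_seq_subset_cball[of \<alpha>, OF assms(4) R] .
  have ne: "?K i \<noteq> {}" for i
    using steiner_seq_nonempty[of \<alpha>, OF assms(4) bK] r by fastforce
  \<comment> \<open>Every subsequential limit is fixed by its own process, so the inclusion lemma
    applies in both directions.\<close>
  have unique: "L = M" if "steiner_subseq_limit \<alpha> K L" "steiner_subseq_limit \<alpha> K M" for L M
    using steiner_subseq_limit_subset[of \<alpha>, OF assms(4) bK assms(2) r(2,1)] that assms(5) by (metis subset_antisym)
  obtain L s where L: "compact L" "L \<noteq> {}" "strict_mono s" "(\<lambda>i. hausdist (?K (s i)) L) \<longlonglongrightarrow> 0"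
    by (rule Blaschke_selection[OF ne sub])
  have limL: "steiner_subseq_limit \<alpha> K L"
    unfolding steiner_subseq_limit_def by (intro conjI exI[of _ s] L)
  have "(\<lambda>i. hausdist (?K i) L) \<longlonglongrightarrow> 0"
  proof (rule ccontr)
    assume "\<not> ?thesis"
    \<comment> \<open>If convergence fails, some subsequence \<open>t\<close> stays at distance at
      least \<open>e\<close> from \<open>L\<close>. Blaschke selection gives it a further convergent
      subsequence, whose limit must be \<open>L\<close> by uniqueness.\<close>
    then obtain e where e: "0 < e" "\<And>N. \<exists>n\<ge>N. e \<le> \<bar>hausdist (?K n) L\<bar>"
      unfolding LIMSEQ_iff by (auto simp: not_less)
    then have "infinite {n. e \<le> \<bar>hausdist (?K n) L\<bar>}"
      unfolding infinite_nat_iff_unbounded_le by auto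
    then obtain t :: "nat \<Rightarrow> nat" where t: "strict_mono t" "\<And>n. e \<le> \<bar>hausdist (?K (t n)) L\<bar>"
      using infinite_enumerate by blast
    obtain M q where M: "compact M" "M \<noteq> {}" "strict_mono q" "(\<lambda>i. hausdist (?K (t (q i))) M) \<longlonglongrightarrow> 0"
      by (rule Blaschke_selection[of "\<lambda>i. ?K (t i)" R, OF ne sub])
    have "strict_mono (\<lambda>i. t (q i))" using strict_mono_o[OF t(1) M(3)] by (simp add: o_def)
    then have "steiner_subseq_limit \<alpha> K M"
      unfolding steiner_subseq_limit_def by (intro conjI exI[of _ "\<lambda>i. t (q i)"] M)
    then have "M = L" using unique limL by blast
    then have "(\<lambda>i. \<bar>hausdist (?K (t (q i))) L\<bar>) \<longlonglongrightarrow> 0" using M(4) tendsto_rabs_zero by blast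
    then have "e \<le> 0" using t(2) by (intro LIMSEQ_le_const) auto
    then show False using e by simp
  qed
  then show ?thesis using L unfolding steiner_limit_def by blast
qed

end
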